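(* Assume $Y$ is an $r$-set, $Y=Y_1\times\dots\times Y_r\times Y_0$, with $Y_1,\dots,Y_r,Y_0$ of finite positive measure, and let $f\in L_2(X)$. Then the error $E(f)=\inf_{g\in\mathcal{R}(\mathbf{a}^1,\dots,\mathbf{a}^r)}\|f-g\|_{L_2(X)}$ equals $$E(f)=|\det J|^{-1/2}\Big(\|f^*\|_{L_2(Y)}^2-\sum_{i=1}^r\frac{1}{|Y^{(i)}|^2}\|f_i^*\|_{L_2(Y)}^2+(r-1)\frac{A^2}{|Y|}\Big)^{1/2},$$ where $f_i^*$ is regarded as a function on $Y$ depending only on $y_i$.
   Context: Let $X\subset\mathbb{R}^n$ have finite Lebesgue measure, let $r\le n$, and let $\mathbf{a}^1,\dots,\mathbf{a}^r\in\mathbb{R}^n$ be linearly independent; complete them to a basis $\mathbf{a}^1,\dots,\mathbf{a}^n$ of $\mathbb{R}^n$. Let $J$ be the linear map $y_i=\mathbf{a}^i\cdot\mathbf{x}$, $i=1,\dots,n$ (so $\det J$ is the determinant of the matrix with rows $\mathbf{a}^1,\dots,\mathbf{a}^n$), with inverse $x_i=\mathbf{b}^i\cdot\mathbf{y}$; set $Y=J(X)$ and $Y_i=\{\mathbf{a}^i\cdot\mathbf{x}:\mathbf{x}\in X\}$. For a function $u$ on $X$ put $u^*(\mathbf{y})=u(\mathbf{b}^1\cdot\mathbf{y},\dots,\mathbf{b}^n\cdot\mathbf{y})$. $Y$ is an $r$-set if $Y=Y_1\times\dots\times Y_r\times Y_0$ for some $Y_0\subset\mathbb{R}^{n-r}$.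 For $j=1,\dots,r$, $Y^{(j)}=Y_1\times\dots\times Y_{j-1}\times Y_{j+1}\times\dots\times Y_r\times Y_0$ and $\int_{Y^{(j)}}\cdots d\mathbf{y}^{(j)}$ integrates over all coordinates except $y_j$; $|\cdot|$ is Lebesgue measure. Set $A=\int_Y f^*(\mathbf{y})\,d\mathbf{y}$ and $f_i^*(y_i)=\int_{Y^{(i)}}f^*(\mathbf{y})\,d\mathbf{y}^{(i)}$, $i=1,\dots,r$. $\mathcal{R}(\mathbf{a}^1,\dots,\mathbf{a}^r)$ is the set of sums $\sum_{i=1}^r g_i(\mathbf{a}^i\cdot\mathbf{x})$ with $g_i:\mathbb{R}\to\mathbb{R}$ and each $g_i(\mathbf{a}^i\cdot\mathbf{x})\in L_2(X)$. *)

theory Defs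
  imports "HOL-Analysis.Analysis"
begin

definition L2_on :: "'a::euclidean_space set \<Rightarrow> ('a \<Rightarrow> real) \<Rightarrow> bool" where
  "L2_on S h \<longleftrightarrow> h \<in> borel_measurable (lebesgue_on S) \<and>
     integrable (lebesgue_on S) (\<lambda>x. (h x)^2)"

definition L2norm_on :: "'a::euclidean_space set \<Rightarrow> ('a \<Rightarrow> real) \<Rightarrow> real" where
  "L2norm_on S h = sqrt (\<integral>x. (h x)^2 \<partial>lebesgue_on S)"

text \<open>Ridge function space R(a^i, i in I): the rows A\$i of A are the vectors a^i;
  sums over i in I of g_i(a^i . x) with each summand in L_2(X).\<close>
definition ridge_space :: "real^'n^'n \<Rightarrow> 'n set \<Rightarrow> (real^'n) set \<Rightarrow> (real^'n \<Rightarrow> real) set" where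
  "ridge_space A I X = {h. \<exists>g :: 'n \<Rightarrow> real \<Rightarrow> real.
      (\<forall>i\<in>I. L2_on X (\<lambda>x. g i (A $ i \<bullet> x))) \<and> h = (\<lambda>x. \<Sum>i\<in>I. g i (A $ i \<bullet> x))}"

definition approx_error :: "real^'n^'n \<Rightarrow> 'n set \<Rightarrow> (real^'n) set \<Rightarrow> (real^'n \<Rightarrow> real) \<Rightarrow> real" where
  "approx_error A I X f = (INF h\<in>ridge_space A I X. L2norm_on X (\<lambda>x. f x - h x))"

definition leb_coords :: "'n set \<Rightarrow> ('n \<Rightarrow> real) measure" where
  "leb_coords K = completion (PiM K (\<lambda>_. lborel))"

definition Yset :: "real^'n^'n \<Rightarrow> (real^'n) set \<Rightarrow> 'n \<Rightarrow> real set" where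
  "Yset A X i = (\<lambda>x. A $ i \<bullet> x) ` X"

definition star_fun :: "real^'n^'n \<Rightarrow> (real^'n \<Rightarrow> real) \<Rightarrow> real^'n \<Rightarrow> real" where
  "star_fun A u = (\<lambda>y. u (matrix_inv A *v y))"

definition Ycomp :: "real^'n^'n \<Rightarrow> (real^'n) set \<Rightarrow> 'n set \<Rightarrow> ('n \<Rightarrow> real) set \<Rightarrow> 'n \<Rightarrow> ('n \<Rightarrow> real) set" where
  "Ycomp A X I Y0 i = {z \<in> PiE (- {i}) (\<lambda>_. UNIV).
      (\<forall>j\<in>I - {i}. z j \<in> Yset A X j) \<and> restrict z (- I) \<in> Y0}"

definition marginal :: "real^'n^'n \<Rightarrow> (real^'n) set \<Rightarrow> 'n set \<Rightarrow> ('n \<Rightarrow> real) set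
    \<Rightarrow> (real^'n \<Rightarrow> real) \<Rightarrow> 'n \<Rightarrow> real \<Rightarrow> real" where
  "marginal A X I Y0 f i t =
     (LINT z:Ycomp A X I Y0 i|leb_coords (- {i}). star_fun A f (\<chi> j. (z(i := t)) j))"

end

theory Submission
  imports Defs
begin

text \<open>
  The substitution \<open>y = A x\<close> turns ridge functions into functions of single coordinates on \<open>Y\<close> and
  scales squared norms by \<open>\<bar>det A\<bar>\<close>. On \<open>Y\<close>, Fubini's theorem along the coordinate \<open>y\<^sub>i\<close> shows that
  the residual \<open>u - \<Sum>\<^sub>i u\<^sub>i(y\<^sub>i) / |Y\<^sup>i| + (r - 1) a / |Y|\<close>, with \<open>u\<^sub>i\<close> the marginals and \<open>a\<close> the
  integral of \<open>u\<close>, is orthogonal to every square-integrable function of one coordinate \<open>y\<^sub>i\<close>. By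
  Pythagoras it is the residual of a best approximation, and expanding its norm gives the formula.
  Only the product structure of \<open>Y\<close> with respect to one coordinate at a time is needed: \<open>Y\<close> is a
  set \<open>S\<close> of values of \<open>y\<^sub>i\<close> times a set \<open>C\<close> in the remaining coordinates.
\<close>

section \<open>Fubini's theorem along one coordinate\<close>

interpretation lborel_PiM: product_sigma_finite "\<lambda>_::'n. lborel :: real measure"
  by standard

text \<open>Each preimage under \<open>g\<close> differs from the one under \<open>f\<close> only
  inside a null set, and completeness makes such a set measurable. The values of \<open>g\<close>
  must be constrained at every point, since the almost-everywhere equality says nothing on the
  exceptional set.\<close>

lemma (in complete_measure) measurable_cong_AE:
  assumes f: "f \<in> M \<rightarrow>\<^sub>M N" and ae: "AE x in M. f x = g x"
    and g: "\<And>x. x \<in> space M \<Longrightarrow> g x \<in> space N"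
  shows "g \<in> M \<rightarrow>\<^sub>M N"
proof (rule measurableI)
  fix B assume B: "B \<in> sets N"
  show "g -` B \<inter> space M \<in> sets M"
    using ae AE_space by (intro in_sets_AE[OF _ measurable_sets[OF f B]]) (auto elim: eventually_elim2)
qed (rule g)

text \<open>Inverse of splitting a vector into its coordinate \<open>i\<close> and the remaining
  ones. The rest \<open>z\<close> is an extensional function on \<open>- {i}\<close>, so its value
  at \<open>i\<close> is a dummy that the update overwrites; this is the form of the argument inside
  \<open>marginal\<close>.\<close>

definition glue :: "'n \<Rightarrow> real \<Rightarrow> ('n \<Rightarrow> real) \<Rightarrow> real^'n" where
  "glue i t z = (\<chi> j. (z(i := t)) j)"

lemma glue_nth [simp]: "glue i t z $ j = (if j = i then t else z j)"
  by (simp add: glue_def)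

lemma measurable_glue [measurable]:
  fixes i :: "'n::finite"
  shows "(\<lambda>(t, z). glue i t z) \<in> borel_measurable (lborel \<Otimes>\<^sub>M PiM (- {i}) (\<lambda>_. lborel))"
proof (subst borel_measurable_euclidean_space, safe)
  fix b :: "real^'n" assume "b \<in> Basis"
  then obtain k where k: "b = axis k 1"
    by (auto simp: Basis_vec_def)
  show "(\<lambda>p. (case p of (t, z) \<Rightarrow> glue i t z) \<bullet> b)
      \<in> borel_measurable (lborel \<Otimes>\<^sub>M PiM (- {i}) (\<lambda>_. lborel))"
    by (cases "k = i") (auto simp: k inner_axis split_beta')
qed

lemma prod_Basis_vec: "(\<Prod>b\<in>(Basis :: (real^'n) set). g b) = (\<Prod>k\<in>UNIV. g (axis k 1))"
proof -
  have "(Basis :: (real^'n) set) = range (\<lambda>k. axis k 1)"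
    by (auto simp: Basis_vec_def)
  moreover have "inj (\<lambda>k::'n. axis k (1::real))"
    by (auto simp: inj_on_def axis_eq_axis)
  ultimately show ?thesis
    by (metis (no_types, lifting) prod.reindex_cong)
qed

text \<open>Lebesgue measure is determined by its values on boxes, and gluing pulls an open box back
  to an interval times a product of intervals.\<close>

lemma lborel_eq_distr_glue:
  fixes i :: "'n::finite"
  shows "(lborel :: (real^'n) measure) =
    distr (lborel \<Otimes>\<^sub>M PiM (- {i}) (\<lambda>_. lborel)) borel (\<lambda>(t, z). glue i t z)" (is "_ = distr ?P _ ?g")
proof (rule lborel_eqI)
  fix l u :: "real^'n"
  assume le: "\<And>b. b \<in> Basis \<Longrightarrow> l \<bullet> b \<le> u \<bullet> b"
  have le': "l $ k \<le> u $ k" for k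
    using le[of "axis k 1"] by (simp add: inner_axis)
  interpret sigma_finite_measure "PiM (- {i}) (\<lambda>_. lborel :: real measure)"
    by (rule lborel_PiM.sigma_finite) simp
  have "?g -` box l u \<inter> space ?P =
      {l $ i <..< u $ i} \<times> PiE (- {i}) (\<lambda>k. {l $ k <..< u $ k})"
  proof (rule set_eqI, clarify)
    fix t z
    show "(t, z) \<in> ?g -` box l u \<inter> space ?P \<longleftrightarrow>
        (t, z) \<in> {l $ i <..< u $ i} \<times> PiE (- {i}) (\<lambda>k. {l $ k <..< u $ k})"
      unfolding mem_box_cart space_pair_measure space_PiM vimage_eq Int_iff mem_Sigma_iff PiE_iff
      by (auto simp: mem_box_cart; metis)
  qed
  then have "emeasure (distr ?P borel ?g) (box l u) =
      emeasure ?P ({l $ i <..< u $ i} \<times> PiE (- {i}) (\<lambda>k. {l $ k <..< u $ k}))"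
    by (simp add: emeasure_distr)
  also have "\<dots> = ennreal (u $ i - l $ i) * (\<Prod>k\<in>- {i}. ennreal (u $ k - l $ k))"
    using le' by (subst emeasure_pair_measure_Times) (auto simp: lborel_PiM.emeasure_PiM intro!: sets_PiM_I_finite)
  also have "\<dots> = (\<Prod>k\<in>UNIV. ennreal (u $ k - l $ k))"
    by (simp add: prod.remove[of UNIV i] Compl_eq_Diff_UNIV)
  also have "\<dots> = ennreal (\<Prod>b\<in>Basis. (u - l) \<bullet> b)"
    using le' by (simp add: prod_Basis_vec inner_axis prod_ennreal)
  finally show "emeasure (distr ?P borel ?g) (box l u) = ennreal (\<Prod>b\<in>Basis. (u - l) \<bullet> b)" .
qed simp

lemma pair_sigma_finite_coords:
  "pair_sigma_finite (lborel :: real measure) (PiM (- {i :: 'n::finite}) (\<lambda>_. lborel :: real measure))"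
  by (intro pair_sigma_finite.intro lborel_PiM.sigma_finite sigma_finite_lborel) simp

lemma AE_lborel_glue:
  fixes i :: "'n::finite"
  assumes "AE y in (lborel :: (real^'n) measure). P y"
  shows "AE t in lborel. AE z in PiM (- {i}) (\<lambda>_. lborel). P (glue i t z)"
proof -
  interpret pair_sigma_finite "lborel :: real measure" "PiM (- {i}) (\<lambda>_. lborel :: real measure)"
    by (rule pair_sigma_finite_coords)
  have "AE p in lborel \<Otimes>\<^sub>M PiM (- {i}) (\<lambda>_. lborel). P (case p of (t, z) \<Rightarrow> glue i t z)"
    using assms unfolding lborel_eq_distr_glue[of i] by (rule AE_distrD[OF measurable_glue])
  from AE_pair[OF this] show ?thesis by simp
qed

lemma nn_integral_lborel_glue:
  fixes F :: "real^'n::finite \<Rightarrow> ennreal"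
  assumes [measurable]: "F \<in> borel_measurable borel"
  shows "(\<integral>\<^sup>+y. F y \<partial>lborel) = (\<integral>\<^sup>+t. \<integral>\<^sup>+z. F (glue i t z) \<partial>PiM (- {i}) (\<lambda>_. lborel) \<partial>lborel)"
proof -
  interpret sigma_finite_measure "PiM (- {i}) (\<lambda>_. lborel :: real measure)"
    by (rule lborel_PiM.sigma_finite) simp
  have "(\<integral>\<^sup>+y. F y \<partial>lborel) =
      (\<integral>\<^sup>+p. F (case p of (t, z) \<Rightarrow> glue i t z) \<partial>(lborel \<Otimes>\<^sub>M PiM (- {i}) (\<lambda>_. lborel)))"
    by (subst lborel_eq_distr_glue[of i], subst nn_integral_distr) auto
  also have "\<dots> = (\<integral>\<^sup>+t. \<integral>\<^sup>+z. F (glue i t z) \<partial>PiM (- {i}) (\<lambda>_. lborel) \<partial>lborel)"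
    by (subst nn_integral_fst[symmetric]) auto
  finally show ?thesis .
qed

text \<open>A Lebesgue measurable \<open>F\<close> has a Borel representative. By
  \<open>AE_lborel_glue\<close> the two agree almost everywhere on almost every slice, so neither
  the inner nor the outer integral changes in passing from one to the other.\<close>

lemma nn_integral_lebesgue_glue:
  fixes F :: "real^'n::finite \<Rightarrow> ennreal"
  assumes "F \<in> borel_measurable lebesgue"
  shows "(\<integral>\<^sup>+y. F y \<partial>lebesgue) = (\<integral>\<^sup>+t. \<integral>\<^sup>+z. F (glue i t z) \<partial>leb_coords (- {i}) \<partial>lebesgue)"
proof -
  obtain F' where F'[measurable]: "F' \<in> borel_measurable borel" and ae: "AE y in lborel. F y = F' y"
    using completion_ex_borel_measurable[OF assms] by auto
  have "(\<integral>\<^sup>+y. F y \<partial>lebesgue) = (\<integral>\<^sup>+y. F' y \<partial>lborel)"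
    using ae by (simp add: nn_integral_completion cong: nn_integral_cong_AE)
  also have "\<dots> = (\<integral>\<^sup>+t. \<integral>\<^sup>+z. F' (glue i t z) \<partial>PiM (- {i}) (\<lambda>_. lborel) \<partial>lborel)"
    by (rule nn_integral_lborel_glue) fact
  also have "\<dots> = (\<integral>\<^sup>+t. \<integral>\<^sup>+z. F (glue i t z) \<partial>PiM (- {i}) (\<lambda>_. lborel) \<partial>lborel)"
  proof (rule nn_integral_cong_AE)
    show "AE t in lborel. (\<integral>\<^sup>+z. F' (glue i t z) \<partial>PiM (- {i}) (\<lambda>_. lborel)) =
        (\<integral>\<^sup>+z. F (glue i t z) \<partial>PiM (- {i}) (\<lambda>_. lborel))"
      using AE_lborel_glue[OF ae, of i]
      by eventually_elim (auto intro!: nn_integral_cong_AE)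
  qed
  finally show ?thesis
    by (simp add: leb_coords_def nn_integral_completion)
qed

text \<open>The Bochner version by the same Borel representative. Slices of a Lebesgue integrable
  function need be integrable only for almost every \<open>t\<close>.\<close>

lemma
  fixes F :: "real^'n::finite \<Rightarrow> real" and i :: 'n
  assumes "integrable lebesgue F"
  shows AE_integrable_lebesgue_glue:
      "AE t in lebesgue. integrable (leb_coords (- {i})) (\<lambda>z. F (glue i t z))" (is ?AE)
    and integrable_lebesgue_glue:
      "integrable lebesgue (\<lambda>t. \<integral>z. F (glue i t z) \<partial>leb_coords (- {i}))" (is ?INT)
    and integral_lebesgue_glue:
      "(\<integral>y. F y \<partial>lebesgue) = (\<integral>t. \<integral>z. F (glue i t z) \<partial>leb_coords (- {i}) \<partial>lebesgue)" (is ?EQ)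
proof -
  let ?M = "PiM (- {i}) (\<lambda>_. lborel :: real measure)"
  interpret pair_sigma_finite "lborel :: real measure" ?M
    by (rule pair_sigma_finite_coords)
  obtain F' where F'[measurable]: "F' \<in> borel_measurable borel" and ae: "AE y in lborel. F y = F' y"
    using completion_ex_borel_measurable_real[OF borel_measurable_integrable[OF assms]] by auto
  have F_meas: "F \<in> borel_measurable lebesgue" and F'_meas: "F' \<in> borel_measurable lebesgue"
    using assms by (auto intro: measurable_completion)
  have aeL: "AE y in lebesgue. F y = F' y"
    using ae by (rule AE_completion)
  have "integrable lebesgue F'"
    using assms integrable_cong_AE[OF F_meas F'_meas aeL] by simp
  then have "integrable lborel F'"
    by (simp add: integrable_completion)
  then have "integrable (distr (lborel \<Otimes>\<^sub>M ?M) borel (\<lambda>(t, z). glue i t z)) F'"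
    by (simp flip: lborel_eq_distr_glue)
  then have int: "integrable (lborel \<Otimes>\<^sub>M ?M) (\<lambda>p. F' (case p of (t, z) \<Rightarrow> glue i t z))"
    by (subst (asm) integrable_distr_eq) auto
  have slice [measurable]: "(\<lambda>z. F' (glue i t z)) \<in> borel_measurable ?M" for t
    using measurable_compose[OF measurable_Pair1'[of t lborel ?M]
        measurable_compose[OF measurable_glue F']] by simp
  have slices: "AE t in lebesgue. AE z in leb_coords (- {i}). F (glue i t z) = F' (glue i t z)"
    unfolding leb_coords_def using AE_lborel_glue[OF ae, of i]
    by (auto simp: AE_completion_iff)
  \<comment> \<open>On a good slice everything transfers from \<open>F'\<close> to \<open>F\<close>;
    measurability of the slice of \<open>F\<close> comes from completeness of
    \<open>leb_coords\<close>.\<close>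
  have slice_eq: "(\<lambda>z. F (glue i t z)) \<in> borel_measurable (leb_coords (- {i})) \<and>
      (integrable (leb_coords (- {i})) (\<lambda>z. F (glue i t z)) \<longleftrightarrow> integrable ?M (\<lambda>z. F' (glue i t z))) \<and>
      (\<integral>z. F (glue i t z) \<partial>leb_coords (- {i})) = (\<integral>z. F' (glue i t z) \<partial>?M)"
    if "AE z in leb_coords (- {i}). F (glue i t z) = F' (glue i t z)" for t
  proof -
    have m': "(\<lambda>z. F' (glue i t z)) \<in> borel_measurable (leb_coords (- {i}))"
      unfolding leb_coords_def by (intro measurable_completion) measurable
    have m: "(\<lambda>z. F (glue i t z)) \<in> borel_measurable (leb_coords (- {i}))"
      using that unfolding leb_coords_def
      by (intro completion.measurable_cong_AE[OF m'[unfolded leb_coords_def]]) (auto elim: eventually_mono)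
    show ?thesis
      using m m' that integrable_cong_AE[OF m m' that] integral_cong_AE[OF m m' that]
      by (simp add: leb_coords_def integrable_completion integral_completion)
  qed
  show ?AE
    using slices AE_completion[OF AE_integrable_fst'[OF int]]
    by eventually_elim (simp add: slice_eq)
  have aeI: "AE t in lebesgue. (\<integral>z. F' (glue i t z) \<partial>?M) = (\<integral>z. F (glue i t z) \<partial>leb_coords (- {i}))"
    using slices by eventually_elim (simp add: slice_eq)
  have I': "integrable lborel (\<lambda>t. \<integral>z. F' (glue i t z) \<partial>?M)"
    using integrable_fst'[OF int] by simp
  then have I'L: "integrable lebesgue (\<lambda>t. \<integral>z. F' (glue i t z) \<partial>?M)"
    by (simp add: integrable_completion)
  \<comment> \<open>The slice integrals of \<open>F\<close> are known only up to a null set of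
    \<open>t\<close>, so completeness is used once more, now in the variable
    \<open>t\<close>.\<close>
  have mI: "(\<lambda>t. \<integral>z. F (glue i t z) \<partial>leb_coords (- {i})) \<in> borel_measurable lebesgue"
    using completion.measurable_cong_AE[OF borel_measurable_integrable[OF I'L] aeI] by simp
  show ?INT
    using I'L aeI mI by (subst integrable_cong_AE[OF mI _ ]) auto
  have "(\<integral>y. F y \<partial>lebesgue) = (\<integral>y. F' y \<partial>lborel)"
    using integral_cong_AE[OF F_meas F'_meas aeL] by (simp add: integral_completion)
  also have "\<dots> = (\<integral>p. F' (case p of (t, z) \<Rightarrow> glue i t z) \<partial>(lborel \<Otimes>\<^sub>M ?M))"
    by (subst lborel_eq_distr_glue[of i], subst integral_distr) auto
  also have "\<dots> = (\<integral>t. \<integral>z. F' (glue i t z) \<partial>?M \<partial>lborel)"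
    using integral_fst'[OF int] by simp
  also have "\<dots> = (\<integral>t. \<integral>z. F' (glue i t z) \<partial>?M \<partial>lebesgue)"
    using I' by (simp add: integral_completion)
  also have "\<dots> = (\<integral>t. \<integral>z. F (glue i t z) \<partial>leb_coords (- {i}) \<partial>lebesgue)"
    using I'L mI aeI by (intro integral_cong_AE) auto
  finally show ?EQ .
qed

section \<open>Linear change of variables\<close>

text \<open>Beyond Borel measurability this needs preimages of null sets to be null. For null
  \<open>N\<close> on the line the preimage is \<open>N\<close> times all other coordinates, and by
  Tonelli its measure is the integral over \<open>t\<close> of a function vanishing off
  \<open>N\<close>.\<close>

lemma lebesgue_measurable_nth:
  fixes i :: "'n::finite"
  shows "(\<lambda>y :: real^'n. y $ i) \<in> lebesgue \<rightarrow>\<^sub>M lebesgue"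
proof (rule completion.measurable_completion2)
  show m: "(\<lambda>y :: real^'n. y $ i) \<in> lebesgue \<rightarrow>\<^sub>M lborel"
    by (intro measurable_completion) simp
  show "null_sets lborel \<subseteq> null_sets (distr lebesgue lborel (\<lambda>y :: real^'n. y $ i))"
  proof
    fix N :: "real set" assume N: "N \<in> null_sets lborel"
    then have [measurable]: "N \<in> sets borel"
      by auto
    have "emeasure (distr lebesgue lborel (\<lambda>y :: real^'n. y $ i)) N =
        (\<integral>\<^sup>+y. indicator N (y $ i) \<partial>(lborel :: (real^'n) measure))"
      using m by (simp add: nn_integral_distr nn_integral_completion flip: nn_integral_indicator)
    also have "\<dots> = (\<integral>\<^sup>+t. \<integral>\<^sup>+z. indicator N t \<partial>PiM (- {i}) (\<lambda>_. lborel :: real measure) \<partial>lborel)"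
      by (subst nn_integral_lborel_glue[of _ i]) auto
    also have "\<dots> = (\<integral>\<^sup>+t. 0 \<partial>(lborel :: real measure))"
      using AE_not_in[OF N] by (intro nn_integral_cong_AE) (auto elim!: eventually_mono)
    finally show "N \<in> null_sets (distr lebesgue lborel (\<lambda>y :: real^'n. y $ i))"
      by (simp add: null_sets_def)
  qed
qed

section \<open>Determinants of elementary matrices\<close>

lemma det_swap_columns_mat:
  fixes m n :: "'n::finite"
  assumes "m \<noteq> n"
  shows "det (\<chi> i j. (mat 1 :: real^'n^'n) $ i $ Transposition.transpose m n j) = - 1"
  using assms det_permute_columns[OF permutes_swap_id[of m UNIV n], of "mat 1 :: real^'n^'n"]
  by (simp add: sign_swap_id)

lemma det_add_row_mat:
  fixes m n :: "'n::finite"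
  assumes "m \<noteq> n"
  shows "det (\<chi> i j. of_bool (i = m \<and> j = n \<or> i = j) :: real^'n^'n) = 1"
proof -
  have "(\<chi> i j. of_bool (i = m \<and> j = n \<or> i = j) :: real^'n^'n) =
      (\<chi> k. if k = m then row m (mat 1) + 1 *s row n (mat 1) else row k (mat 1))"
    using assms by (auto simp: vec_eq_iff row_def mat_def)
  then show ?thesis
    using det_row_operation[OF assms, of "mat 1 :: real^'n^'n" 1] by simp
qed

text \<open>The change of variables for linear maps in the library needs a well-ordered index type; here it is
  derived for any finite one from elementary matrices, a shear being a translation in one coordinate
  while the others are frozen.\<close>

lemma nn_integral_lborel_matrix:
  fixes A :: "real^'n^'n" and F :: "real^'n \<Rightarrow> ennreal"
  assumes "det A \<noteq> 0" "F \<in> borel_measurable borel"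
  shows "(\<integral>\<^sup>+y. F y \<partial>lborel) = ennreal \<bar>det A\<bar> * (\<integral>\<^sup>+x. F (A *v x) \<partial>lborel)"
proof -
  have mv [measurable]: "(\<lambda>x. B *v x) \<in> borel_measurable borel" for B :: "real^'n^'n"
    by (intro borel_measurable_continuous_onI linear_continuous_on matrix_vector_mul_bounded_linear)
  \<comment> \<open>The determinant condition sits inside the induction because matrices with a zero
    row occur there and satisfy the claim vacuously. \<open>F\<close> is quantified because for a
    product the hypothesis on the right factor is applied to \<open>F\<close> composed with the left
    one.\<close>
  have "det A \<noteq> 0 \<longrightarrow> (\<forall>F :: real^'n \<Rightarrow> ennreal. F \<in> borel_measurable borel \<longrightarrow>
      (\<integral>\<^sup>+y. F y \<partial>lborel) = ennreal \<bar>det A\<bar> * (\<integral>\<^sup>+x. F (A *v x) \<partial>lborel))" (is "?P A")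
  proof (induction A rule: induct_matrix_elementary_alt)
    case (1 A B)
    show ?case
    proof (intro impI allI)
      fix F :: "real^'n \<Rightarrow> ennreal"
      assume "det (A ** B) \<noteq> 0" and [measurable]: "F \<in> borel_measurable borel"
      then have "det A \<noteq> 0" "det B \<noteq> 0"
        by (auto simp: det_mul)
      have FA: "(\<lambda>x. F (A *v x)) \<in> borel_measurable borel"
        by measurable
      have "(\<integral>\<^sup>+y. F y \<partial>lborel) = ennreal \<bar>det A\<bar> * (\<integral>\<^sup>+x. F (A *v x) \<partial>lborel)"
        "(\<integral>\<^sup>+x. F (A *v x) \<partial>lborel) = ennreal \<bar>det B\<bar> * (\<integral>\<^sup>+x. F (A *v (B *v x)) \<partial>lborel)"
        by (rule 1(1)[rule_format], fact+) (rule 1(2)[rule_format], fact+)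
      then show "(\<integral>\<^sup>+y. F y \<partial>lborel) = ennreal \<bar>det (A ** B)\<bar> * (\<integral>\<^sup>+x. F ((A ** B) *v x) \<partial>lborel)"
        by (simp only: det_mul abs_mult ennreal_mult abs_ge_zero matrix_vector_mul_assoc mult.assoc)
    qed
  next
    case (2 A i)
    then show ?case
      by (simp add: det_zero_row)
  next
    case (3 A)
    show ?case
    proof (intro impI allI)
      fix F :: "real^'n \<Rightarrow> ennreal"
      assume "det A \<noteq> 0" and [measurable]: "F \<in> borel_measurable borel"
      \<comment> \<open>The diagonal entries as a function on \<open>Basis\<close>, the form in
        which \<open>lborel_affine_euclidean\<close> takes its scaling factors; its translation part
        is 0, hence the \<open>0 +\<close> in \<open>T\<close>.\<close>
      define c where "c b = (A *v b) \<bullet> b" for b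
      have c_axis: "c (axis k 1) = A $ k $ k" for k
        by (simp add: c_def matrix_vector_mul_component inner_axis column_def matrix_vector_mult_basis)
      have det: "det A = (\<Prod>k\<in>UNIV. A $ k $ k)"
        using 3 by (rule det_diagonal)
      then have nz: "A $ k $ k \<noteq> 0" for k
        using \<open>det A \<noteq> 0\<close> by auto
      have T: "0 + (\<Sum>j\<in>Basis. (c j * (x \<bullet> j)) *\<^sub>R j) = A *v x" for x
      proof (subst vec_eq_iff, rule allI)
        fix k
        have "(A *v x) $ k = (\<Sum>j\<in>UNIV. if j = k then A $ k $ k * x $ k else 0)"
          unfolding matrix_vector_mult_def vec_lambda_beta
          using 3 by (intro sum.cong) auto
        moreover have "(\<Sum>j\<in>Basis. (c j * (x \<bullet> j)) *\<^sub>R j) $ k =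
            (\<Sum>j\<in>Basis. (c j * (x \<bullet> j)) *\<^sub>R j) \<bullet> axis k 1"
          by (simp add: inner_axis)
        moreover have "\<dots> = c (axis k 1) * (x \<bullet> axis k 1)"
          by (subst inner_sum_left_Basis) auto
        ultimately show "(0 + (\<Sum>j\<in>Basis. (c j * (x \<bullet> j)) *\<^sub>R j)) $ k = (A *v x) $ k"
          by (simp add: c_axis inner_axis)
      qed
      have "lborel = density (distr lborel borel (\<lambda>x. A *v x)) (\<lambda>_. ennreal (\<Prod>j\<in>Basis. \<bar>c j\<bar>))"
      proof -
        have "c j \<noteq> 0" if "j \<in> Basis" for j
          using that nz c_axis by (auto simp: Basis_vec_def)
        from lborel_affine_euclidean[of c 0, OF this] show ?thesis
          unfolding T .
      qed
      also have "(\<Prod>j\<in>Basis. \<bar>c j\<bar>) = \<bar>det A\<bar>"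
        by (simp add: prod_Basis_vec c_axis det abs_prod)
      finally have eq: "lborel = density (distr lborel borel (\<lambda>x. A *v x)) (\<lambda>_. ennreal \<bar>det A\<bar>)" .
      show "(\<integral>\<^sup>+y. F y \<partial>lborel) = ennreal \<bar>det A\<bar> * (\<integral>\<^sup>+x. F (A *v x) \<partial>lborel)"
        by (subst eq) (simp add: nn_integral_density nn_integral_distr nn_integral_cmult)
    qed
  next
    case (4 m n)
    let ?S = "(\<chi> i j. mat 1 $ i $ Transposition.transpose m n j) :: real^'n^'n"
    let ?p = "Transposition.transpose m n"
    have Sv: "(?S *v x) $ k = x $ ?p k" for x k
    proof -
      have "(?S *v x) $ k = (\<Sum>j\<in>UNIV. if j = ?p k then x $ j else 0)"
        unfolding matrix_vector_mult_def vec_lambda_beta mat_def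
        by (intro sum.cong) (auto simp: transpose_eq_iff)
      then show ?thesis by simp
    qed
    \<comment> \<open>Permuting coordinates carries a box to a box with the same side lengths, so
      the pushforward gives every box its old measure.\<close>
    have eq: "lborel = distr lborel borel (\<lambda>x. ?S *v x)"
    proof (rule lborel_eqI)
      fix l u :: "real^'n"
      assume le: "\<And>b. b \<in> Basis \<Longrightarrow> l \<bullet> b \<le> u \<bullet> b"
      have le': "l $ k \<le> u $ k" for k
        using le[of "axis k 1"] by (simp add: inner_axis)
      have "(\<lambda>x. ?S *v x) -` box l u = box (\<chi> k. l $ ?p k) (\<chi> k. u $ ?p k)"
        by (auto simp: mem_box_cart Sv) (metis transpose_involutory)+
      then have "emeasure (distr lborel borel (\<lambda>x. ?S *v x)) (box l u) =
          emeasure lborel (box ((\<chi> k. l $ ?p k) :: real^'n) (\<chi> k. u $ ?p k))"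
        by (subst emeasure_distr) auto
      also have "\<dots> = ennreal (\<Prod>k\<in>UNIV. u $ ?p k - l $ ?p k)"
      proof -
        have "((\<chi> k. l $ ?p k) :: real^'n) \<bullet> b \<le> (\<chi> k. u $ ?p k) \<bullet> b" if "b \<in> Basis" for b
          using that le' by (auto simp: Basis_vec_def inner_axis)
        from emeasure_lborel_box[OF this] show ?thesis
          by (simp add: prod_Basis_vec inner_axis)
      qed
      also have "(\<Prod>k\<in>UNIV. u $ ?p k - l $ ?p k) = (\<Prod>k\<in>UNIV. u $ k - l $ k)"
        by (rule prod.reindex_bij_betw) (simp add: bij_swap)
      finally show "emeasure (distr lborel borel (\<lambda>x. ?S *v x)) (box l u) = (\<Prod>b\<in>Basis. (u - l) \<bullet> b)"
        by (simp add: prod_Basis_vec inner_axis)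
    qed simp
    have "(\<integral>\<^sup>+y. F y \<partial>lborel) = (\<integral>\<^sup>+x. F (?S *v x) \<partial>lborel)"
      if [measurable]: "F \<in> borel_measurable borel" for F
      by (subst eq) (simp add: nn_integral_distr)
    moreover have "ennreal \<bar>det ?S\<bar> = 1"
      by (simp add: det_swap_columns_mat[OF \<open>m \<noteq> n\<close>])
    ultimately show ?case
      by (metis mult_1)
  next
    case (5 m n)
    let ?S = "(\<chi> i j. of_bool (i = m \<and> j = n \<or> i = j)) :: real^'n^'n"
    have Sv: "?S *v glue m t z = glue m (z n + 1 * t) z" for t z
    proof (subst vec_eq_iff, rule allI)
      fix k
      have "(?S *v glue m t z) $ k =
          (\<Sum>j\<in>UNIV. (if j = k then glue m t z $ k else 0) + (if j = n then of_bool (k = m) * z n else 0))"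
        unfolding matrix_vector_mult_def vec_lambda_beta
        using \<open>m \<noteq> n\<close> by (intro sum.cong) auto
      also have "\<dots> = glue m (z n + 1 * t) z $ k"
        by (simp add: sum.distrib)
      finally show "(?S *v glue m t z) $ k = glue m (z n + 1 * t) z $ k" .
    qed
    show ?case
    proof (intro impI allI)
      fix F :: "real^'n \<Rightarrow> ennreal"
      assume F [measurable]: "F \<in> borel_measurable borel"
      let ?M = "PiM (- {m}) (\<lambda>_. lborel :: real measure)"
      interpret pair_sigma_finite "lborel :: real measure" ?M
        by (rule pair_sigma_finite_coords)
      have FS: "(\<lambda>x. F (?S *v x)) \<in> borel_measurable borel"
        by measurable
      \<comment> \<open>The order is exchanged so that the integral over \<open>t\<close> becomes
        the inner one, where translation invariance applies for each fixed \<open>z\<close>.\<close>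
      have swap: "(\<integral>\<^sup>+t. \<integral>\<^sup>+z. G (glue m t z) \<partial>?M \<partial>lborel) = (\<integral>\<^sup>+z. \<integral>\<^sup>+t. G (glue m t z) \<partial>lborel \<partial>?M)"
        if [measurable]: "G \<in> borel_measurable borel" for G :: "real^'n \<Rightarrow> ennreal"
        by (rule Fubini'[symmetric]) (use measurable_compose[OF measurable_glue that] in \<open>simp add: split_beta'\<close>)
      have sl: "(\<lambda>t. F (glue m t z)) \<in> borel_measurable borel" if "z \<in> space ?M" for z
        using measurable_compose[OF measurable_Pair2'[OF that, of lborel]
          measurable_compose[OF measurable_glue F]] by simp
      have "(\<integral>\<^sup>+x. F (?S *v x) \<partial>lborel) = (\<integral>\<^sup>+z. \<integral>\<^sup>+t. F (glue m (z n + 1 * t) z) \<partial>lborel \<partial>?M)"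
        by (subst nn_integral_lborel_glue[OF FS, of m], subst swap[OF FS], simp only: Sv)
      also have "\<dots> = (\<integral>\<^sup>+z. \<integral>\<^sup>+t. F (glue m t z) \<partial>lborel \<partial>?M)"
      proof (rule nn_integral_cong)
        fix z :: "'n \<Rightarrow> real" assume "z \<in> space ?M"
        from nn_integral_real_affine[OF sl[OF this], of 1 "z n"]
        show "(\<integral>\<^sup>+t. F (glue m (z n + 1 * t) z) \<partial>lborel) = (\<integral>\<^sup>+t. F (glue m t z) \<partial>lborel)"
          by simp
      qed
      also have "\<dots> = (\<integral>\<^sup>+y. F y \<partial>lborel)"
        by (simp only: nn_integral_lborel_glue[OF F, of m] swap[OF F])
      finally have "(\<integral>\<^sup>+x. F (?S *v x) \<partial>lborel) = (\<integral>\<^sup>+y. F y \<partial>lborel)" .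
      moreover have "ennreal \<bar>det ?S\<bar> = 1"
        by (subst det_add_row_mat[OF \<open>m \<noteq> n\<close>]) simp
      ultimately show "(\<integral>\<^sup>+y. F y \<partial>lborel) = ennreal \<bar>det ?S\<bar> * (\<integral>\<^sup>+x. F (?S *v x) \<partial>lborel)"
        by (metis mult_1)
    qed
  qed
  with assms show ?thesis by blast
qed

text \<open>The Borel formula passes to the completion because \<open>det A \<noteq> 0\<close> makes
  a Borel set null exactly when its preimage is null. This equality of null sets also yields
  measurability from \<open>lebesgue\<close> to \<open>lebesgue\<close>.\<close>

lemma
  fixes A :: "real^'n^'n"
  assumes "det A \<noteq> 0"
  shows lebesgue_matrix: "lebesgue = density (distr lebesgue lebesgue (\<lambda>x. A *v x)) (\<lambda>_. ennreal \<bar>det A\<bar>)"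
    and lebesgue_measurable_matrix: "(\<lambda>x. A *v x) \<in> lebesgue \<rightarrow>\<^sub>M lebesgue"
proof -
  let ?T = "\<lambda>x :: real^'n. A *v x"
  have T[measurable]: "?T \<in> borel_measurable borel"
    by (intro borel_measurable_continuous_onI linear_continuous_on matrix_vector_mul_bounded_linear)
  have lb: "lborel = density (distr lborel borel ?T) (\<lambda>_. ennreal \<bar>det A\<bar>)"
  proof (rule measure_eqI)
    fix B :: "(real^'n) set" assume "B \<in> sets lborel"
    then have [measurable]: "B \<in> sets borel" by simp
    show "emeasure lborel B = emeasure (density (distr lborel borel ?T) (\<lambda>_. ennreal \<bar>det A\<bar>)) B"
      using nn_integral_lborel_matrix[OF assms, of "indicator B"]
        nn_integral_distr[of ?T lborel borel "indicator B"]
      by (simp add: emeasure_density nn_integral_cmult)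
  qed simp
  have eq: "null_sets lborel = null_sets (distr lebesgue lborel ?T)"
  proof -
    have "emeasure lborel B = 0 \<longleftrightarrow> emeasure (distr lebesgue lborel ?T) B = 0" if "B \<in> sets borel" for B
      using that assms
      by (subst lb) (simp add: distr_completion emeasure_density nn_integral_cmult cong: distr_cong)
    then show ?thesis
      by (auto simp: null_sets_def)
  qed
  show "?T \<in> lebesgue \<rightarrow>\<^sub>M lebesgue"
    by (simp add: completion.measurable_completion2 eq measurable_completion)
  have "lebesgue = completion (density (distr lborel borel ?T) (\<lambda>_. ennreal \<bar>det A\<bar>))"
    by (subst lb) simp
  also have "\<dots> = density (completion (distr lebesgue lborel ?T)) (\<lambda>_. ennreal \<bar>det A\<bar>)"
    using assms by (auto intro!: completion_density_eq simp: distr_completion cong: distr_cong)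
  also have "\<dots> = density (distr lebesgue lebesgue ?T) (\<lambda>_. ennreal \<bar>det A\<bar>)"
    by (subst completion.completion_distr_eq) (auto simp: eq measurable_completion)
  finally show "lebesgue = density (distr lebesgue lebesgue ?T) (\<lambda>_. ennreal \<bar>det A\<bar>)" .
qed

section \<open>Marginals on a product set\<close>

text \<open>Cauchy-Schwarz against the constant 1, obtained by expanding the nonnegative integral of
  the square of \<open>?m * v x - ?J\<close>.\<close>

lemma (in finite_measure) integral_square_le:
  fixes v :: "'a \<Rightarrow> real"
  assumes "integrable M v" "integrable M (\<lambda>x. (v x)\<^sup>2)" and pos: "0 < measure M (space M)"
  shows "(\<integral>x. v x \<partial>M)\<^sup>2 \<le> measure M (space M) * (\<integral>x. (v x)\<^sup>2 \<partial>M)"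
proof -
  let ?m = "measure M (space M)" and ?J = "\<integral>x. v x \<partial>M"
  have "0 \<le> (\<integral>x. (?m * v x - ?J)\<^sup>2 \<partial>M)"
    by simp
  also have "\<dots> = (\<integral>x. ?m\<^sup>2 * (v x)\<^sup>2 - 2 * ?m * ?J * v x + ?J\<^sup>2 \<partial>M)"
    by (simp add: power2_eq_square algebra_simps)
  also have "\<dots> = ?m\<^sup>2 * (\<integral>x. (v x)\<^sup>2 \<partial>M) - 2 * ?m * ?J * ?J + ?J\<^sup>2 * ?m"
    using assms(1,2) by simp
  also have "\<dots> = ?m * (?m * (\<integral>x. (v x)\<^sup>2 \<partial>M) - ?J\<^sup>2)"
    by (simp add: power2_eq_square algebra_simps)
  finally show ?thesis
    using pos by (simp add: zero_le_mult_iff)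
qed

lemma glue_restrict_nth: "glue i (y $ i) (restrict (\<lambda>j. y $ j) (- {i})) = y"
  by (simp add: vec_eq_iff)

lemma space_leb_coords: "space (leb_coords K) = PiE K (\<lambda>_. UNIV)"
  by (simp add: leb_coords_def space_PiM)

text \<open>The product structure of \<open>Y\<close> in direction \<open>i\<close>, phrased
  pointwise through \<open>glue\<close>. Measurability, finiteness and positivity of
  \<open>C\<close> are consequences derived below, so an instance only has to supply the membership
  equivalence for it.\<close>

locale slab =
  fixes Y :: "(real^'n::finite) set" and i :: 'n and S :: "real set" and C :: "('n \<Rightarrow> real) set"
  assumes Y_lmeasurable: "Y \<in> lmeasurable" and S_lmeasurable: "S \<in> lmeasurable"
    and Y_pos: "0 < measure lebesgue Y" and S_pos: "0 < measure lebesgue S"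
    and C_subset: "C \<subseteq> PiE (- {i}) (\<lambda>_. UNIV)"
    and glue_mem_iff: "\<And>t z. z \<in> PiE (- {i}) (\<lambda>_. UNIV) \<Longrightarrow> glue i t z \<in> Y \<longleftrightarrow> t \<in> S \<and> z \<in> C"
begin

text \<open>Not normalised: dividing by the measure of \<open>C\<close> gives the mean of
  \<open>u\<close> over the slice.\<close>

definition marg :: "(real^'n \<Rightarrow> real) \<Rightarrow> real \<Rightarrow> real" where
  "marg u t = (LINT z:C|leb_coords (- {i}). u (glue i t z))"

lemma Y_sets [simp, measurable]: "Y \<in> sets lebesgue" and S_sets [simp, measurable]: "S \<in> sets lebesgue"
  using Y_lmeasurable S_lmeasurable by auto

lemma nth_mem: "y \<in> Y \<Longrightarrow> y $ i \<in> S"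
  using glue_mem_iff[of "restrict (\<lambda>j. y $ j) (- {i})" "y $ i"] by (simp add: glue_restrict_nth)

lemma indicator_glue:
  "z \<in> space (leb_coords (- {i})) \<Longrightarrow> indicator Y (glue i t z) = (indicator S t * indicator C z :: real)"
  by (simp add: glue_mem_iff space_leb_coords indicator_def)

lemma integral_glue_indicator:
  "(\<integral>z. indicator Y (glue i t z) *\<^sub>R u (glue i t z) \<partial>leb_coords (- {i})) = indicator S t *\<^sub>R marg u t"
proof -
  have "(\<integral>z. indicator Y (glue i t z) *\<^sub>R u (glue i t z) \<partial>leb_coords (- {i})) =
      (\<integral>z. indicator S t * (indicator C z *\<^sub>R u (glue i t z)) \<partial>leb_coords (- {i}))"
    by (intro Bochner_Integration.integral_cong) (auto simp: indicator_glue)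
  then show ?thesis
    by (simp add: marg_def set_lebesgue_integral_def)
qed

text \<open>Fubini for \<open>u\<close> extended by zero off \<open>Y\<close>. The indicator of
  \<open>Y\<close> factors into those of \<open>S\<close> and \<open>C\<close>, which turns the
  slice integral into \<open>marg\<close> and leaves an outer integral over
  \<open>S\<close>.\<close>

lemma
  assumes "integrable (lebesgue_on Y) u"
  shows AE_set_integrable_marg: "AE t in lebesgue_on S. set_integrable (leb_coords (- {i})) C (\<lambda>z. u (glue i t z))"
    and integrable_marg: "integrable (lebesgue_on S) (marg u)"
    and integral_marg: "(\<integral>y. u y \<partial>lebesgue_on Y) = (\<integral>t. marg u t \<partial>lebesgue_on S)"
proof -
  have int: "integrable lebesgue (\<lambda>y. indicator Y y *\<^sub>R u y)"
    using assms by (simp add: integrable_restrict_space)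
  have "AE t in lebesgue. t \<in> S \<longrightarrow> set_integrable (leb_coords (- {i})) C (\<lambda>z. u (glue i t z))"
    using AE_integrable_lebesgue_glue[OF int, of i]
  proof eventually_elim
    case (elim t)
    show ?case
    proof
      assume "t \<in> S"
      show "set_integrable (leb_coords (- {i})) C (\<lambda>z. u (glue i t z))"
        unfolding set_integrable_def
        by (rule Bochner_Integration.integrable_cong[THEN iffD1, OF refl _ elim])
          (simp add: indicator_glue \<open>t \<in> S\<close>)
    qed
  qed
  then show "AE t in lebesgue_on S. set_integrable (leb_coords (- {i})) C (\<lambda>z. u (glue i t z))"
    by (simp add: AE_restrict_space_iff)
  show "integrable (lebesgue_on S) (marg u)"
    using integrable_lebesgue_glue[OF int, of i]
    by (simp add: integral_glue_indicator[simplified] integrable_restrict_space)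
  show "(\<integral>y. u y \<partial>lebesgue_on Y) = (\<integral>t. marg u t \<partial>lebesgue_on S)"
    using integral_lebesgue_glue[OF int, of i]
    by (simp add: integral_glue_indicator[simplified] integral_restrict_space)
qed

lemma marg_nth_mult: "marg (\<lambda>y. h (y $ i) * u y) t = h t * marg u t"
  by (simp add: marg_def set_lebesgue_integral_def mult.left_commute)

text \<open>For almost every \<open>t\<close> in \<open>S\<close> the slice of the constant 1 is
  integrable, and that slice is the indicator of \<open>C\<close> whatever \<open>t\<close> is.
  Since \<open>S\<close> is not null, such a \<open>t\<close> exists.\<close>

lemma C_integrable: "integrable (leb_coords (- {i})) (indicator C :: _ \<Rightarrow> real)"
proof -
  have "integrable (lebesgue_on Y) (\<lambda>_. 1 :: real)"
    using Y_lmeasurable by (simp add: finite_measure.integrable_const finite_measure_lebesgue_on)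
  from AE_set_integrable_marg[OF this]
  have ae: "AE t in lebesgue_on S. integrable (leb_coords (- {i})) (indicator C :: _ \<Rightarrow> real)"
    by (simp add: set_integrable_def)
  show ?thesis
  proof (rule ccontr)
    assume "\<not> ?thesis"
    with ae have "AE t in lebesgue. t \<notin> S"
      by (simp add: AE_restrict_space_iff)
    then have "measure lebesgue S = 0"
      by (simp add: completion.null_sets_iff_AE[THEN iffD2] measure_eq_0_null_sets)
    with S_pos show False by simp
  qed
qed

lemma C_sets [simp, measurable]: "C \<in> sets (leb_coords (- {i}))"
proof -
  have "(indicator C :: _ \<Rightarrow> real) \<in> borel_measurable (leb_coords (- {i}))"
    using C_integrable by auto
  then show ?thesis
    using C_subset by (simp add: borel_measurable_indicator_iff space_leb_coords Int_absorb2)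
qed

lemma C_finite: "emeasure (leb_coords (- {i})) C < \<infinity>"
  using C_integrable C_subset by (simp add: integrable_indicator_iff space_leb_coords Int_absorb2)

lemma marg_const: "marg (\<lambda>_. b) t = b * measure (leb_coords (- {i})) C"
  using C_subset by (simp add: marg_def set_lebesgue_integral_def space_leb_coords Int_absorb2)

lemma marg_nth: "marg (\<lambda>y. h (y $ i)) t = h t * measure (leb_coords (- {i})) C"
  using marg_nth_mult[of h "\<lambda>_. 1" t] by (simp add: marg_const)

lemma measure_eq: "measure lebesgue Y = measure lebesgue S * measure (leb_coords (- {i})) C"
proof -
  have "integrable (lebesgue_on Y) (\<lambda>_. 1 :: real)"
    using Y_lmeasurable by (simp add: finite_measure.integrable_const finite_measure_lebesgue_on)
  from integral_marg[OF this] show ?thesis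
    by (simp add: marg_const measure_restrict_space)
qed

lemma C_pos: "0 < measure (leb_coords (- {i})) C"
  using measure_eq Y_pos S_pos by (simp add: zero_less_mult_iff)

lemma borel_measurable_nth:
  assumes "h \<in> borel_measurable (lebesgue_on S)"
  shows "(\<lambda>y. h (y $ i) :: real) \<in> borel_measurable (lebesgue_on Y)"
proof -
  have "(\<lambda>t. indicator S t *\<^sub>R h t) \<in> borel_measurable lebesgue"
    using assms by (subst (asm) borel_measurable_restrict_space_iff) auto
  from measurable_compose[OF lebesgue_measurable_nth this]
  have "(\<lambda>y. indicator S (y $ i) *\<^sub>R h (y $ i)) \<in> borel_measurable (lebesgue_on Y)"
    by (rule measurable_restrict_space1)
  then show ?thesis
    by (rule measurable_cong[THEN iffD1, rotated]) (simp add: nth_mem)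
qed

text \<open>By Tonelli the integral of the norm over \<open>Y\<close> is the one over
  \<open>S\<close> times the finite measure of \<open>C\<close>.\<close>

lemma integrable_nth:
  assumes h: "integrable (lebesgue_on S) h"
  shows "integrable (lebesgue_on Y) (\<lambda>y. h (y $ i) :: real)"
proof (rule integrableI_bounded)
  show m: "(\<lambda>y. h (y $ i)) \<in> borel_measurable (lebesgue_on Y)"
    using h by (intro borel_measurable_nth) auto
  have mn: "(\<lambda>y. ennreal (norm (h (y $ i))) * indicator Y y) \<in> borel_measurable lebesgue"
    using m by (subst borel_measurable_restrict_space_iff_ennreal[symmetric]) auto
  have "(\<integral>\<^sup>+y. norm (h (y $ i)) \<partial>lebesgue_on Y) =
      (\<integral>\<^sup>+t. \<integral>\<^sup>+z. ennreal (norm (h t)) * indicator Y (glue i t z) \<partial>leb_coords (- {i}) \<partial>lebesgue)"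
    using nn_integral_lebesgue_glue[OF mn, of i] by (simp add: nn_integral_restrict_space)
  also have "\<dots> = (\<integral>\<^sup>+t. \<integral>\<^sup>+z. (ennreal (norm (h t)) * indicator S t) * indicator C z
      \<partial>leb_coords (- {i}) \<partial>lebesgue)"
    by (intro nn_integral_cong) (auto simp: glue_mem_iff space_leb_coords indicator_def)
  also have "\<dots> = (\<integral>\<^sup>+t. (ennreal (norm (h t)) * indicator S t) * emeasure (leb_coords (- {i})) C \<partial>lebesgue)"
    by (simp add: nn_integral_cmult_indicator)
  also have "\<dots> = (\<integral>\<^sup>+t. norm (h t) \<partial>lebesgue_on S) * emeasure (leb_coords (- {i})) C"
  proof (subst nn_integral_multc)
    show "(\<lambda>t. ennreal (norm (h t)) * indicator S t) \<in> borel_measurable lebesgue"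
      using h by (subst borel_measurable_restrict_space_iff_ennreal[symmetric]) auto
  qed (simp add: nn_integral_restrict_space)
  also have "\<dots> < \<infinity>"
    using h C_finite by (simp add: integrable_iff_bounded ennreal_mult_less_top)
  finally show "(\<integral>\<^sup>+y. norm (h (y $ i)) \<partial>lebesgue_on Y) < \<infinity>" .
qed

lemma integral_nth:
  fixes h :: "real \<Rightarrow> real"
  assumes "integrable (lebesgue_on Y) (\<lambda>y. h (y $ i))"
  shows "(\<integral>y. h (y $ i) \<partial>lebesgue_on Y) = (\<integral>t. h t \<partial>lebesgue_on S) * measure (leb_coords (- {i})) C"
  using integral_marg[OF assms] by (simp add: marg_nth)

text \<open>The marginal of \<open>h (y $ i)\<close> is \<open>h\<close> times the measure of
  \<open>C\<close>, and this factor can be divided out because it is positive.\<close>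

lemma integrable_of_nth:
  fixes h :: "real \<Rightarrow> real"
  assumes "integrable (lebesgue_on Y) (\<lambda>y. h (y $ i))"
  shows "integrable (lebesgue_on S) h"
  using integrable_marg[OF assms] C_pos by (simp add: marg_nth[abs_def])

text \<open>The slices of \<open>Y\<close> do not depend on \<open>t\<close>, so the marginal is constant in \<open>t\<close>, and its value
  is read off by integrating over \<open>S\<close>.\<close>

lemma marg_other_nth:
  assumes "j \<noteq> i" "integrable (lebesgue_on Y) (\<lambda>y. h (y $ j))"
  shows "marg (\<lambda>y. h (y $ j)) t = (\<integral>y. h (y $ j) \<partial>lebesgue_on Y) / measure lebesgue S"
proof -
  have *: "marg (\<lambda>y. h (y $ j)) s = marg (\<lambda>y. h (y $ j)) t" for s
    using \<open>j \<noteq> i\<close> by (simp add: marg_def)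
  have "(\<integral>y. h (y $ j) \<partial>lebesgue_on Y) = (\<integral>s. marg (\<lambda>y. h (y $ j)) t \<partial>lebesgue_on S)"
    unfolding integral_marg[OF assms(2)] by (intro Bochner_Integration.integral_cong refl *)
  also have "\<dots> = measure lebesgue S * marg (\<lambda>y. h (y $ j)) t"
    by (simp add: measure_restrict_space)
  finally show ?thesis
    using S_pos by simp
qed

lemma L2_on_imp_integrable:
  assumes "L2_on Y u"
  shows "integrable (lebesgue_on Y) u"
proof (rule finite_measure.square_integrable_imp_integrable)
  show "finite_measure (lebesgue_on Y)"
    by (rule finite_measure_lebesgue_on[OF Y_lmeasurable])
qed (use assms in \<open>simp_all add: L2_on_def\<close>)

text \<open>Cauchy-Schwarz on almost every slice bounds the square of the marginal of
  \<open>u\<close> by the measure of \<open>C\<close> times the marginal of the square of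
  \<open>u\<close>, which is integrable over \<open>S\<close> by Fubini.\<close>

lemma L2_on_marg_nth:
  assumes u: "L2_on Y u"
  shows "L2_on Y (\<lambda>y. marg u (y $ i))"
proof -
  let ?K = "leb_coords (- {i})"
  have int: "integrable (lebesgue_on Y) u" and int2: "integrable (lebesgue_on Y) (\<lambda>y. (u y)\<^sup>2)"
    using u L2_on_imp_integrable[OF u] by (simp_all add: L2_on_def)
  have m: "marg u \<in> borel_measurable (lebesgue_on S)"
    using integrable_marg[OF int] by auto
  interpret finite_measure "restrict_space ?K C"
  proof
    show "emeasure (restrict_space ?K C) (space (restrict_space ?K C)) \<noteq> \<infinity>"
      using C_finite C_subset
      by (simp add: emeasure_restrict_space space_restrict_space space_leb_coords Int_absorb2)
  qed
  have "AE t in lebesgue_on S. norm ((marg u t)\<^sup>2) \<le>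
      norm (measure ?K C * marg (\<lambda>y. (u y)\<^sup>2) t)"
    using AE_set_integrable_marg[OF int] AE_set_integrable_marg[OF int2]
  proof eventually_elim
    case (elim t)
    have "(marg u t)\<^sup>2 \<le> measure ?K C * marg (\<lambda>y. (u y)\<^sup>2) t"
      using integral_square_le[of "\<lambda>z. u (glue i t z)"] elim C_pos
      by (simp add: marg_def set_lebesgue_integral_def set_integrable_def integral_restrict_space
          integrable_restrict_space measure_restrict_space space_restrict_space)
    then show ?case by simp
  qed
  then have "integrable (lebesgue_on S) (\<lambda>t. (marg u t)\<^sup>2)"
    using m integrable_marg[OF int2]
    by (intro Bochner_Integration.integrable_bound[OF integrable_mult_right[OF integrable_marg[OF int2]]])
      (rule borel_measurable_power)
  then show ?thesis
    unfolding L2_on_def using borel_measurable_nth[OF m] integrable_nth[of "\<lambda>t. (marg u t)\<^sup>2"] by simp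
qed

end

section \<open>Best approximation by sums of functions of one coordinate\<close>

lemma L2_on_mult_integrable:
  assumes "L2_on Y u" "L2_on Y v"
  shows "integrable (lebesgue_on Y) (\<lambda>y. u y * v y)"
proof (rule Bochner_Integration.integrable_bound)
  show "integrable (lebesgue_on Y) (\<lambda>y. (u y)\<^sup>2 + (v y)\<^sup>2)"
    using assms by (simp add: L2_on_def)
  show "(\<lambda>y. u y * v y) \<in> borel_measurable (lebesgue_on Y)"
    using assms by (simp add: L2_on_def borel_measurable_times)
  have "\<bar>a * b\<bar> \<le> a\<^sup>2 + b\<^sup>2" for a b :: real
    using sum_squares_bound[of "\<bar>a\<bar>" "\<bar>b\<bar>"] abs_ge_zero[of "a * b"] unfolding abs_mult power2_abs by linarith
  then show "AE y in lebesgue_on Y. norm (u y * v y) \<le> norm ((u y)\<^sup>2 + (v y)\<^sup>2)"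
    by simp
qed

lemma L2_on_diff:
  assumes "L2_on Y u" "L2_on Y v"
  shows "L2_on Y (\<lambda>y. u y - v y)"
  using assms L2_on_mult_integrable[OF assms]
  by (simp add: L2_on_def power2_diff borel_measurable_diff mult.assoc)

lemma L2_on_cmult: "L2_on Y u \<Longrightarrow> L2_on Y (\<lambda>y. c * u y)"
  by (simp add: L2_on_def power_mult_distrib borel_measurable_times)

lemma L2_on_add:
  assumes "L2_on Y u" "L2_on Y v"
  shows "L2_on Y (\<lambda>y. u y + v y)"
  using L2_on_diff[OF assms(1) L2_on_cmult[OF assms(2), of "- 1"]] by simp

lemma L2_on_const: "Y \<in> lmeasurable \<Longrightarrow> L2_on Y (\<lambda>_. c)"
  by (simp add: L2_on_def finite_measure.integrable_const finite_measure_lebesgue_on)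

lemma L2_on_sum:
  assumes "finite J" "\<And>j. j \<in> J \<Longrightarrow> L2_on Y (u j)"
  shows "L2_on Y (\<lambda>y. \<Sum>j\<in>J. u j y)"
  using assms by (induction J) (auto intro: L2_on_add simp: L2_on_def[of _ "\<lambda>_. 0"])

text \<open>The minimiser is \<open>g i t = m i t / K i - \<beta>\<close>, where \<open>\<beta>\<close> shares the constant \<open>(r - 1) a / V\<close>
  equally among the \<open>r\<close> directions.\<close>

lemma slabs_best_approximation:
  fixes Y :: "(real^'n) set" and I :: "'n set" and u :: "real^'n \<Rightarrow> real"
  assumes "I \<noteq> {}" and slab: "\<And>i. i \<in> I \<Longrightarrow> slab Y i (S i) (C i)" and u: "L2_on Y u"
  defines "m \<equiv> \<lambda>i. slab.marg i (C i) u"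
  defines "K \<equiv> \<lambda>i. measure (leb_coords (- {i})) (C i)"
  defines "E \<equiv> (\<integral>y. (u y)\<^sup>2 \<partial>lebesgue_on Y)
      - (\<Sum>i\<in>I. (1 / (K i)\<^sup>2) * (\<integral>y. (m i (y $ i))\<^sup>2 \<partial>lebesgue_on Y))
      + (real (card I) - 1) * (\<integral>y. u y \<partial>lebesgue_on Y)\<^sup>2 / measure lebesgue Y"
  obtains g :: "'n \<Rightarrow> real \<Rightarrow> real"
  where "\<And>i. i \<in> I \<Longrightarrow> L2_on Y (\<lambda>y. g i (y $ i))"
    and "(\<integral>y. (u y - (\<Sum>i\<in>I. g i (y $ i)))\<^sup>2 \<partial>lebesgue_on Y) = E"
    and "\<And>k. (\<And>i. i \<in> I \<Longrightarrow> L2_on Y (\<lambda>y. k i (y $ i))) \<Longrightarrow>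
      E \<le> (\<integral>y. (u y - (\<Sum>i\<in>I. k i (y $ i)))\<^sup>2 \<partial>lebesgue_on Y)"
proof
  obtain i0 where "i0 \<in> I"
    using \<open>I \<noteq> {}\<close> by auto
  then have Y: "Y \<in> lmeasurable" and V_pos: "0 < measure lebesgue Y"
    using slab[of i0] by (auto simp: slab_def)
  define V where "V = measure lebesgue Y"
  define a where "a = (\<integral>y. u y \<partial>lebesgue_on Y)"
  define r where "r = real (card I)"
  have r_pos: "r > 0"
    using \<open>I \<noteq> {}\<close> by (simp add: r_def card_gt_0_iff)
  define \<beta> where "\<beta> = (r - 1) * a / (r * V)"
  define g where "g = (\<lambda>i t. m i t / K i - \<beta>)"
  define R where "R = (\<lambda>y :: real^'n. u y - (\<Sum>i\<in>I. g i (y $ i)))"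
  have V: "V > 0"
    using V_pos by (simp add: V_def)
  have \<beta>: "r * \<beta> = (r - 1) * a / V"
    using r_pos V by (simp add: \<beta>_def)
  have K_pos: "K i > 0" if "i \<in> I" for i
    using slab.C_pos[OF slab[OF that]] by (simp add: K_def)
  have m_L2: "L2_on Y (\<lambda>y. m i (y $ i))" if "i \<in> I" for i
    using slab.L2_on_marg_nth[OF slab[OF that] u] by (simp add: m_def)
  show g_L2: "L2_on Y (\<lambda>y. g i (y $ i))" if "i \<in> I" for i
    using L2_on_diff[OF L2_on_cmult[OF m_L2[OF that], of "1 / K i"] L2_on_const[OF Y, of \<beta>]]
    by (simp add: g_def)
  have R_L2: "L2_on Y R"
    unfolding R_def by (intro L2_on_diff u L2_on_sum g_L2) auto
  have L2_int: "integrable (lebesgue_on Y) v" if "L2_on Y v" for v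
    by (rule slab.L2_on_imp_integrable[OF slab[OF \<open>i0 \<in> I\<close>] that])

  \<comment> \<open>Integrals of functions of one coordinate\<close>
  have u_int: "integrable (lebesgue_on Y) u"
    by (rule L2_int[OF u])
  \<comment> \<open>A function of \<open>y $ i\<close> factors out of the slice integral, so pairing
    \<open>u\<close> with it only sees the marginal \<open>m i\<close>.\<close>
  have u_times: "integrable (lebesgue_on (S i)) (\<lambda>t. m i t * k t)"
      "(\<integral>y. u y * k (y $ i) \<partial>lebesgue_on Y) = (\<integral>t. m i t * k t \<partial>lebesgue_on (S i))"
    if i: "i \<in> I" and k: "L2_on Y (\<lambda>y. k (y $ i))" for i k
  proof -
    have int: "integrable (lebesgue_on Y) (\<lambda>y. k (y $ i) * u y)"
      by (rule L2_on_mult_integrable[OF k u])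
    have marg: "slab.marg i (C i) (\<lambda>y. k (y $ i) * u y) = (\<lambda>t. m i t * k t)"
      by (simp add: fun_eq_iff slab.marg_nth_mult[OF slab[OF i]] m_def)
    show "integrable (lebesgue_on (S i)) (\<lambda>t. m i t * k t)"
      using slab.integrable_marg[OF slab[OF i] int] by (simp only: marg)
    show "(\<integral>y. u y * k (y $ i) \<partial>lebesgue_on Y) = (\<integral>t. m i t * k t \<partial>lebesgue_on (S i))"
      using slab.integral_marg[OF slab[OF i] int] by (simp only: marg mult.commute[of "u _"])
  qed
  have int_nth: "integrable (lebesgue_on (S i)) k"
      "(\<integral>y. k (y $ i) \<partial>lebesgue_on Y) = (\<integral>t. k t \<partial>lebesgue_on (S i)) * K i"
    if "i \<in> I" "integrable (lebesgue_on Y) (\<lambda>y. k (y $ i))" for i and k :: "real \<Rightarrow> real"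
    using slab.integrable_of_nth[OF slab] slab.integral_nth[OF slab] that by (simp_all add: K_def)
  have m_integral: "(\<integral>t. m i t \<partial>lebesgue_on (S i)) = a" if "i \<in> I" for i
    using slab.integral_marg[OF slab[OF that] u_int] by (simp add: m_def a_def)
  \<comment> \<open>The value is the same for all \<open>i\<close>; hence all off-diagonal terms
    below are equal.\<close>
  have g_integral: "(\<integral>y. g i (y $ i) \<partial>lebesgue_on Y) = a - \<beta> * V" if "i \<in> I" for i
  proof -
    have "(\<integral>y. g i (y $ i) \<partial>lebesgue_on Y) = (\<integral>y. m i (y $ i) / K i \<partial>lebesgue_on Y) - \<beta> * V"
      unfolding g_def using L2_int[OF m_L2[OF that]] L2_int[OF L2_on_const[OF Y]] Y
      by (subst Bochner_Integration.integral_diff) (auto simp: V_def measure_restrict_space)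
    also have "(\<integral>y. m i (y $ i) / K i \<partial>lebesgue_on Y) = a"
      using int_nth(2)[OF that L2_int[OF m_L2[OF that]]] K_pos[OF that] m_integral[OF that] by simp
    finally show ?thesis .
  qed

  \<comment> \<open>Of the summands of the approximant, the one for \<open>i\<close> reproduces the
    pairing of \<open>u\<close> with \<open>k\<close> up to a multiple of the integral of
    \<open>k\<close>. Each of the other \<open>r - 1\<close> contributes a multiple of that integral
    as well, and \<beta> balances these multiples.\<close>
  have orth: "(\<integral>y. R y * k (y $ i) \<partial>lebesgue_on Y) = 0"
    if i: "i \<in> I" and k: "L2_on Y (\<lambda>y. k (y $ i))" for i k
  proof -
    interpret slab Y i "S i" "C i"
      by (rule slab[OF i])
    let ?P = "\<integral>y. u y * k (y $ i) \<partial>lebesgue_on Y" and ?\<kappa> = "\<integral>y. k (y $ i) \<partial>lebesgue_on Y"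
    have k_int: "integrable (lebesgue_on (S i)) k" and \<kappa>: "?\<kappa> = (\<integral>t. k t \<partial>lebesgue_on (S i)) * K i"
      using int_nth[OF i L2_int[OF k]] by auto
    have gk_int: "integrable (lebesgue_on Y) (\<lambda>y. g j (y $ j) * k (y $ i))" if "j \<in> I" for j
      by (rule L2_on_mult_integrable[OF g_L2[OF that] k])
    have diag: "(\<integral>y. g i (y $ i) * k (y $ i) \<partial>lebesgue_on Y) = ?P - \<beta> * ?\<kappa>"
    proof -
      have "(\<integral>y. g i (y $ i) * k (y $ i) \<partial>lebesgue_on Y) = (\<integral>t. g i t * k t \<partial>lebesgue_on (S i)) * K i"
        by (rule int_nth(2)[OF i gk_int[OF i]])
      also have "(\<integral>t. g i t * k t \<partial>lebesgue_on (S i)) =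
          (\<integral>t. m i t * k t / K i - \<beta> * k t \<partial>lebesgue_on (S i))"
        by (simp add: g_def algebra_simps)
      also have "\<dots> = (\<integral>t. m i t * k t \<partial>lebesgue_on (S i)) / K i - \<beta> * (\<integral>t. k t \<partial>lebesgue_on (S i))"
        using u_times(1)[OF i k] k_int by simp
      finally show ?thesis
        using K_pos[OF i] u_times(2)[OF i k] \<kappa> by (simp add: left_diff_distrib)
    qed
    \<comment> \<open>Since \<open>j \<noteq> i\<close>, the marginal of \<open>g j\<close> along
      \<open>i\<close> is constant by \<open>marg_other_nth\<close>, so the pairing is the product
      of the two integrals divided by \<open>V\<close>.\<close>
    have off_diag: "(\<integral>y. g j (y $ j) * k (y $ i) \<partial>lebesgue_on Y) = (a - \<beta> * V) * ?\<kappa> / V"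
      if j: "j \<in> I - {i}" for j
    proof -
      have int: "integrable (lebesgue_on Y) (\<lambda>y. k (y $ i) * g j (y $ j))"
        using gk_int j by (simp add: mult.commute)
      have "marg (\<lambda>y. k (y $ i) * g j (y $ j)) t = k t * ((a - \<beta> * V) / measure lebesgue (S i))" for t
        using marg_other_nth[of j "g j" t] j L2_int[OF g_L2] g_integral
        by (simp add: marg_nth_mult[of k "\<lambda>y. g j (y $ j)" t])
      then have "(\<integral>y. g j (y $ j) * k (y $ i) \<partial>lebesgue_on Y) =
          (\<integral>t. k t \<partial>lebesgue_on (S i)) * ((a - \<beta> * V) / measure lebesgue (S i))"
        using integral_marg[OF int] by (simp add: mult.commute)
      moreover have "?\<kappa> / V = (\<integral>t. k t \<partial>lebesgue_on (S i)) / measure lebesgue (S i)"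
        using \<kappa> measure_eq K_pos[OF i] by (simp add: V_def K_def)
      ultimately show ?thesis
        by (metis mult.commute times_divide_eq_left times_divide_eq_right)
    qed
    have "(\<integral>y. R y * k (y $ i) \<partial>lebesgue_on Y) =
        (\<integral>y. u y * k (y $ i) - (\<Sum>j\<in>I. g j (y $ j) * k (y $ i)) \<partial>lebesgue_on Y)"
      by (simp add: R_def left_diff_distrib sum_distrib_right)
    also have "\<dots> = ?P - (\<Sum>j\<in>I. \<integral>y. g j (y $ j) * k (y $ i) \<partial>lebesgue_on Y)"
      using gk_int L2_on_mult_integrable[OF u k] by (simp add: Bochner_Integration.integral_sum)
    also have "(\<Sum>j\<in>I. \<integral>y. g j (y $ j) * k (y $ i) \<partial>lebesgue_on Y) =
        (?P - \<beta> * ?\<kappa>) + (r - 1) * ((a - \<beta> * V) * ?\<kappa> / V)"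
    proof -
      have "real (card (I - {i})) = r - 1"
        using arg_cong[OF card_Suc_Diff1[OF finite i], of real] unfolding r_def of_nat_Suc by linarith
      then show ?thesis
        using i by (simp add: sum.remove[of I i] diag off_diag del: card_Diff_insert)
    qed
    \<comment> \<open>The two copies of \<open>?P\<close> cancel, and the remaining factor of
      \<open>?\<kappa>\<close> vanishes by the choice of \<beta>.\<close>
    also have "?P - \<dots> = ?\<kappa> * (r * \<beta> - (r - 1) * a / V)"
      using V by (simp add: field_simps)
    finally show ?thesis
      by (simp add: \<beta>)
  qed

  have orth_sum: "(\<integral>y. R y * (\<Sum>i\<in>I. k i (y $ i)) \<partial>lebesgue_on Y) = 0"
    if k: "\<And>i. i \<in> I \<Longrightarrow> L2_on Y (\<lambda>y. k i (y $ i))" for k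
  proof -
    have "(\<integral>y. R y * (\<Sum>i\<in>I. k i (y $ i)) \<partial>lebesgue_on Y) =
        (\<Sum>i\<in>I. \<integral>y. R y * k i (y $ i) \<partial>lebesgue_on Y)"
      unfolding sum_distrib_left
      by (intro Bochner_Integration.integral_sum L2_on_mult_integrable R_L2 k)
    then show ?thesis
      using orth k by simp
  qed

  have ug: "(\<integral>y. u y * g i (y $ i) \<partial>lebesgue_on Y) =
      (1 / (K i)\<^sup>2) * (\<integral>y. (m i (y $ i))\<^sup>2 \<partial>lebesgue_on Y) - \<beta> * a" if i: "i \<in> I" for i
  proof -
    have m2: "integrable (lebesgue_on Y) (\<lambda>y. (m i (y $ i))\<^sup>2)"
      using m_L2[OF i] by (simp add: L2_on_def)
    have "(\<integral>y. u y * g i (y $ i) \<partial>lebesgue_on Y) = (\<integral>t. m i t * g i t \<partial>lebesgue_on (S i))"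
      by (rule u_times(2)[OF i g_L2[OF i]])
    also have "\<dots> = (\<integral>t. (m i t)\<^sup>2 / K i - \<beta> * m i t \<partial>lebesgue_on (S i))"
      by (simp add: g_def algebra_simps power2_eq_square)
    also have "\<dots> = (\<integral>t. (m i t)\<^sup>2 \<partial>lebesgue_on (S i)) / K i - \<beta> * a"
      using int_nth(1)[OF i m2] int_nth(1)[OF i L2_int[OF m_L2[OF i]]] m_integral[OF i] by simp
    finally show ?thesis
      using int_nth(2)[OF i m2] K_pos[OF i] by (simp add: power2_eq_square)
  qed

  \<comment> \<open>\<open>R\<close> is orthogonal to its own approximant, so its squared norm is
    its pairing with \<open>u\<close>. By \<open>ug\<close> each direction contributes
    \<open>\<beta> * a\<close>, and \<open>r * \<beta> * a\<close> is the last term of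
    \<open>E\<close>.\<close>
  show R_norm: "(\<integral>y. (u y - (\<Sum>i\<in>I. g i (y $ i)))\<^sup>2 \<partial>lebesgue_on Y) = E"
  proof -
    have G_L2: "L2_on Y (\<lambda>y. \<Sum>i\<in>I. g i (y $ i))"
      by (intro L2_on_sum g_L2) auto
    have "(\<integral>y. (u y - (\<Sum>i\<in>I. g i (y $ i)))\<^sup>2 \<partial>lebesgue_on Y) =
        (\<integral>y. R y * u y - R y * (\<Sum>i\<in>I. g i (y $ i)) \<partial>lebesgue_on Y)"
      by (simp add: R_def power2_eq_square right_diff_distrib)
    also have "\<dots> = (\<integral>y. R y * u y \<partial>lebesgue_on Y)"
      using L2_on_mult_integrable[OF R_L2 u] L2_on_mult_integrable[OF R_L2 G_L2] orth_sum[OF g_L2] by simp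
    also have "\<dots> = (\<integral>y. (u y)\<^sup>2 - (\<Sum>i\<in>I. u y * g i (y $ i)) \<partial>lebesgue_on Y)"
      by (intro Bochner_Integration.integral_cong refl)
        (simp add: R_def power2_eq_square algebra_simps sum_distrib_left)
    also have "\<dots> = (\<integral>y. (u y)\<^sup>2 \<partial>lebesgue_on Y) - (\<Sum>i\<in>I. \<integral>y. u y * g i (y $ i) \<partial>lebesgue_on Y)"
      using u L2_on_mult_integrable[OF u g_L2] by (simp add: L2_on_def Bochner_Integration.integral_sum)
    also have "\<dots> = (\<integral>y. (u y)\<^sup>2 \<partial>lebesgue_on Y)
      - (\<Sum>i\<in>I. (1 / (K i)\<^sup>2) * (\<integral>y. (m i (y $ i))\<^sup>2 \<partial>lebesgue_on Y)) + (r * \<beta>) * a"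
      by (simp add: ug sum_subtractf r_def)
    also have "\<dots> = E"
      unfolding \<beta> E_def by (simp add: r_def a_def V_def power2_eq_square)
    finally show ?thesis .
  qed

  show "E \<le> (\<integral>y. (u y - (\<Sum>i\<in>I. k i (y $ i)))\<^sup>2 \<partial>lebesgue_on Y)"
    if k: "\<And>i. i \<in> I \<Longrightarrow> L2_on Y (\<lambda>y. k i (y $ i))" for k
  proof -
    \<comment> \<open>The difference between a competitor's residual and \<open>R\<close> is again a
      sum of one-coordinate functions, hence orthogonal to \<open>R\<close>; Pythagoras leaves the
      nonnegative excess given by the square of \<open>W\<close>.\<close>
    define W where "W = (\<lambda>y :: real^'n. \<Sum>i\<in>I. g i (y $ i) - k i (y $ i))"
    have gk_L2: "L2_on Y (\<lambda>y. g i (y $ i) - k i (y $ i))" if "i \<in> I" for i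
      by (intro L2_on_diff g_L2 k that)
    then have W_L2: "L2_on Y W"
      unfolding W_def by (intro L2_on_sum) auto
    have RW: "(\<integral>y. R y * W y \<partial>lebesgue_on Y) = 0"
      unfolding W_def using orth_sum[of "\<lambda>i t. g i t - k i t"] gk_L2 by simp
    have "(\<integral>y. (u y - (\<Sum>i\<in>I. k i (y $ i)))\<^sup>2 \<partial>lebesgue_on Y) =
        (\<integral>y. (R y)\<^sup>2 + 2 * (R y * W y) + (W y)\<^sup>2 \<partial>lebesgue_on Y)"
      by (intro Bochner_Integration.integral_cong)
        (auto simp: R_def W_def sum_subtractf power2_eq_square algebra_simps)
    also have "\<dots> = E + (\<integral>y. (W y)\<^sup>2 \<partial>lebesgue_on Y)"
      using R_L2 W_L2 L2_on_mult_integrable[OF R_L2 W_L2] RW R_norm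
      by (simp add: L2_on_def R_def)
    finally show ?thesis
      by simp
  qed
qed

section \<open>Ridge functions\<close>

lemma matrix_inv_mult:
  fixes A :: "'a::semiring_1^'n^'m"
  assumes "invertible A"
  shows "A ** matrix_inv A = mat 1" "matrix_inv A ** A = mat 1"
  using someI_ex[OF assms[unfolded invertible_def]] by (simp_all add: matrix_inv_def)

lemma matrix_inv_mult_vec:
  fixes A :: "real^'n^'n"
  assumes "invertible A"
  shows "matrix_inv A *v (A *v x) = x" "A *v (matrix_inv A *v x) = x"
  using matrix_inv_mult[OF assms] by (simp_all add: matrix_vector_mul_assoc)

lemma borel_measurable_lebesgue_matrix_iff:
  fixes A :: "real^'n^'n" and F :: "real^'n \<Rightarrow> 'b::topological_space"
  assumes "invertible A"
  shows "(\<lambda>x. F (A *v x)) \<in> borel_measurable lebesgue \<longleftrightarrow> F \<in> borel_measurable lebesgue"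
proof
  have "invertible (matrix_inv A)"
    using matrix_inv_mult[OF assms] unfolding invertible_def by blast
  then have inv: "(\<lambda>x. matrix_inv A *v x) \<in> lebesgue \<rightarrow>\<^sub>M lebesgue"
    by (intro lebesgue_measurable_matrix) (simp add: invertible_det_nz)
  assume "(\<lambda>x. F (A *v x)) \<in> borel_measurable lebesgue"
  from measurable_compose[OF inv this] show "F \<in> borel_measurable lebesgue"
    by (simp add: matrix_inv_mult_vec[OF assms])
next
  assume "F \<in> borel_measurable lebesgue"
  moreover have "(\<lambda>x. A *v x) \<in> lebesgue \<rightarrow>\<^sub>M lebesgue"
    using assms by (intro lebesgue_measurable_matrix) (simp add: invertible_det_nz)
  ultimately show "(\<lambda>x. F (A *v x)) \<in> borel_measurable lebesgue"
    by (rule measurable_compose[rotated])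
qed

lemma
  fixes A :: "real^'n^'n" and F :: "real^'n \<Rightarrow> real"
  assumes "invertible A"
  shows integrable_lebesgue_matrix_iff:
      "integrable lebesgue (\<lambda>x. F (A *v x)) \<longleftrightarrow> integrable lebesgue F" (is ?INT)
    and integral_lebesgue_matrix:
      "(\<integral>y. F y \<partial>lebesgue) = \<bar>det A\<bar> * (\<integral>x. F (A *v x) \<partial>lebesgue)" (is ?EQ)
proof -
  have det: "det A \<noteq> 0"
    using assms by (simp add: invertible_det_nz)
  note T = lebesgue_measurable_matrix[OF det]
  let ?D = "distr lebesgue lebesgue (\<lambda>x. A *v x)"
  have "integrable lebesgue (\<lambda>x. F (A *v x)) \<longleftrightarrow> integrable lebesgue F"
    and "(\<integral>y. F y \<partial>lebesgue) = \<bar>det A\<bar> * (\<integral>x. F (A *v x) \<partial>lebesgue)"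
    if F: "F \<in> borel_measurable lebesgue"
  proof -
    have "integrable lebesgue F \<longleftrightarrow> integrable (density ?D (\<lambda>_. ennreal \<bar>det A\<bar>)) F"
      by (subst lebesgue_matrix[OF det]) (rule refl)
    then show "integrable lebesgue (\<lambda>x. F (A *v x)) \<longleftrightarrow> integrable lebesgue F"
      using F T det by (simp add: integrable_density integrable_distr_eq)
    have "(\<integral>y. F y \<partial>lebesgue) = (\<integral>y. F y \<partial>density ?D (\<lambda>_. ennreal \<bar>det A\<bar>))"
      by (subst lebesgue_matrix[OF det]) (rule refl)
    then show "(\<integral>y. F y \<partial>lebesgue) = \<bar>det A\<bar> * (\<integral>x. F (A *v x) \<partial>lebesgue)"
      using F T by (simp add: integral_density integral_distr)
  qed
  \<comment> \<open>For nonmeasurable \<open>F\<close> neither function is integrable, so both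
    integrals take the default value 0 and the formula persists.\<close>
  moreover have "\<not> integrable lebesgue (\<lambda>x. F (A *v x))" "\<not> integrable lebesgue F"
    if "F \<notin> borel_measurable lebesgue"
    using that borel_measurable_lebesgue_matrix_iff[OF assms, of F] by auto
  ultimately show ?INT ?EQ
    by (cases "F \<in> borel_measurable lebesgue"; simp add: not_integrable_integral_eq)+
qed

lemma indicator_matrix_image:
  fixes A :: "real^'n^'n"
  assumes "invertible A"
  shows "indicator ((\<lambda>x. A *v x) ` X) (A *v x) = indicator X x"
proof -
  have "inj ((*v) A)"
    by (rule inj_on_inverseI[of _ "(*v) (matrix_inv A)"]) (rule matrix_inv_mult_vec[OF assms])
  then show ?thesis
    by (simp add: indicator_def inj_image_mem_iff)
qed

text \<open>The indicator of the image composed with the matrix is the indicator of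
  \<open>X\<close>, so measurability of \<open>X\<close> passes to the image through
  \<open>borel_measurable_lebesgue_matrix_iff\<close>.\<close>

lemma sets_lebesgue_matrix_image:
  fixes A :: "real^'n^'n"
  assumes "invertible A" "X \<in> sets lebesgue"
  shows "(\<lambda>x. A *v x) ` X \<in> sets lebesgue"
proof -
  have "(\<lambda>x. indicator ((\<lambda>x. A *v x) ` X) (A *v x) :: real) \<in> borel_measurable lebesgue"
    using assms by (simp add: indicator_matrix_image borel_measurable_indicator)
  then show ?thesis
    unfolding borel_measurable_lebesgue_matrix_iff[OF assms(1), of "indicator _"]
    by (simp add: borel_measurable_indicator_iff)
qed

lemma
  fixes A :: "real^'n^'n" and F :: "real^'n \<Rightarrow> real"
  assumes A: "invertible A" and X: "X \<in> sets lebesgue"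
  shows L2_on_matrix_image_iff: "L2_on ((\<lambda>x. A *v x) ` X) F \<longleftrightarrow> L2_on X (\<lambda>x. F (A *v x))"
    and integral_matrix_image:
      "(\<integral>y. F y \<partial>lebesgue_on ((\<lambda>x. A *v x) ` X)) = \<bar>det A\<bar> * (\<integral>x. F (A *v x) \<partial>lebesgue_on X)"
proof -
  note Y = sets_lebesgue_matrix_image[OF A X]
  let ?Y = "(\<lambda>x. A *v x) ` X"
  have ind: "(\<lambda>x. indicator X x *\<^sub>R G (A *v x)) = (\<lambda>x. (\<lambda>y. indicator ?Y y *\<^sub>R G y) (A *v x))"
    for G :: "real^'n \<Rightarrow> real"
    by (simp add: indicator_matrix_image[OF A])
  show "L2_on ?Y F \<longleftrightarrow> L2_on X (\<lambda>x. F (A *v x))"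
    using X Y unfolding L2_on_def
    by (simp only: borel_measurable_restrict_space_iff integrable_restrict_space sets.Int_space_eq2
        ind ind[of "\<lambda>y. (F y)\<^sup>2"]
        borel_measurable_lebesgue_matrix_iff[OF A, of "\<lambda>y. indicator ?Y y *\<^sub>R F y"]
        integrable_lebesgue_matrix_iff[OF A, of "\<lambda>y. indicator ?Y y *\<^sub>R (F y)\<^sup>2"])
  show "(\<integral>y. F y \<partial>lebesgue_on ?Y) = \<bar>det A\<bar> * (\<integral>x. F (A *v x) \<partial>lebesgue_on X)"
    using X Y
    by (simp only: integral_restrict_space sets.Int_space_eq2 ind
        integral_lebesgue_matrix[OF A, of "\<lambda>y. indicator ?Y y *\<^sub>R F y"])
qed

lemma integral_lebesgue_on_null:
  fixes F :: "'a::euclidean_space \<Rightarrow> real"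
  assumes "Y \<in> null_sets lebesgue"
  shows "(\<integral>y. F y \<partial>lebesgue_on Y) = 0"
  using assms AE_not_in[OF assms]
  by (intro integral_eq_zero_AE) (auto simp: AE_restrict_space_iff null_setsD2)

lemma L2norm_on_matrix_image:
  fixes A :: "real^'n^'n" and F :: "real^'n \<Rightarrow> real"
  assumes "invertible A" "X \<in> sets lebesgue"
  shows "L2norm_on X (\<lambda>x. F (A *v x)) =
    inverse (sqrt \<bar>det A\<bar>) * sqrt (\<integral>y. (F y)\<^sup>2 \<partial>lebesgue_on ((\<lambda>x. A *v x) ` X))"
  using assms integral_matrix_image[OF assms, of "\<lambda>y. (F y)\<^sup>2"]
  by (simp add: L2norm_on_def real_sqrt_mult invertible_det_nz)

theorem theorem3p2:
  fixes X :: "(real^'n) set" and A :: "real^'n^'n" and I :: "'n set"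
    and Y0 :: "('n \<Rightarrow> real) set" and f :: "real^'n \<Rightarrow> real"
  defines "Y \<equiv> (\<lambda>x. A *v x) ` X"
  assumes X_meas: "X \<in> sets lebesgue" and X_fin: "emeasure lebesgue X < \<infinity>"
    and A_inv: "invertible A"
    and I_ne: "I \<noteq> {}"
    and rset: "Y = {y. (\<forall>i\<in>I. y $ i \<in> Yset A X i) \<and> restrict (\<lambda>j. y $ j) (- I) \<in> Y0}"
    and Yi_meas: "\<forall>i\<in>I. Yset A X i \<in> sets lebesgue \<and> 0 < emeasure lebesgue (Yset A X i)
                          \<and> emeasure lebesgue (Yset A X i) < \<infinity>"
    and Y0_meas: "Y0 \<in> sets (leb_coords (- I))"
    and Y0_pos: "0 < emeasure (leb_coords (- I)) Y0"
    and Y0_fin: "emeasure (leb_coords (- I)) Y0 < \<infinity>"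
    and f_L2: "L2_on X f"
  shows "approx_error A I X f =
    inverse (sqrt \<bar>det A\<bar>) *
    sqrt ((\<integral>y. (star_fun A f y)^2 \<partial>lebesgue_on Y)
          - (\<Sum>i\<in>I. (1 / (measure (leb_coords (- {i})) (Ycomp A X I Y0 i))^2)
                     * (\<integral>y. (marginal A X I Y0 f i (y $ i))^2 \<partial>lebesgue_on Y))
          + (real (card I) - 1) * (\<integral>y. star_fun A f y \<partial>lebesgue_on Y)^2
              / measure lebesgue Y)"
proof -
  let ?u = "star_fun A f"
  let ?E = "(\<integral>y. (?u y)^2 \<partial>lebesgue_on Y)
          - (\<Sum>i\<in>I. (1 / (measure (leb_coords (- {i})) (Ycomp A X I Y0 i))^2)
                     * (\<integral>y. (marginal A X I Y0 f i (y $ i))^2 \<partial>lebesgue_on Y))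
          + (real (card I) - 1) * (\<integral>y. ?u y \<partial>lebesgue_on Y)^2
              / measure lebesgue Y"
  have f_eq: "f x = ?u (A *v x)" for x
    by (simp add: star_fun_def matrix_inv_mult_vec[OF A_inv])
  have Y_sets: "Y \<in> sets lebesgue"
    unfolding Y_def by (rule sets_lebesgue_matrix_image[OF A_inv X_meas])
  have row: "A $ i \<bullet> x = (A *v x) $ i" for i x
    by (simp add: matrix_vector_mul_component)
  have L2_iff: "L2_on X (\<lambda>x. F (A *v x)) \<longleftrightarrow> L2_on Y F" for F
    unfolding Y_def by (rule L2_on_matrix_image_iff[OF A_inv X_meas, symmetric])
  \<comment> \<open>In the coordinates \<open>A *v x\<close> the ridge directions become coordinate
    directions, and the condition on each summand moves from \<open>X\<close> to
    \<open>Y\<close>.\<close>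
  have ridge: "h \<in> ridge_space A I X \<longleftrightarrow> (\<exists>g. (\<forall>i\<in>I. L2_on Y (\<lambda>y. g i (y $ i))) \<and>
      h = (\<lambda>x. \<Sum>i\<in>I. g i ((A *v x) $ i)))" for h
    using L2_iff[of "\<lambda>y. g i (y $ i)" for g :: "'n \<Rightarrow> real \<Rightarrow> real" and i]
    by (simp add: ridge_space_def row)
  have norm: "L2norm_on X (\<lambda>x. f x - (\<Sum>i\<in>I. g i ((A *v x) $ i))) =
      inverse (sqrt \<bar>det A\<bar>) * sqrt (\<integral>y. (?u y - (\<Sum>i\<in>I. g i (y $ i)))\<^sup>2 \<partial>lebesgue_on Y)" for g
    using L2norm_on_matrix_image[OF A_inv X_meas, of "\<lambda>y. ?u y - (\<Sum>i\<in>I. g i (y $ i))"]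
    by (simp add: f_eq Y_def)
  obtain g where g: "\<forall>i\<in>I. L2_on Y (\<lambda>y. g i (y $ i))"
    and g_eq: "(\<integral>y. (?u y - (\<Sum>i\<in>I. g i (y $ i)))\<^sup>2 \<partial>lebesgue_on Y) = ?E"
    and g_min: "\<And>k. (\<And>i. i \<in> I \<Longrightarrow> L2_on Y (\<lambda>y. k i (y $ i))) \<Longrightarrow>
      ?E \<le> (\<integral>y. (?u y - (\<Sum>i\<in>I. k i (y $ i)))\<^sup>2 \<partial>lebesgue_on Y)"
  \<comment> \<open>\<open>slab\<close> demands positive measure of \<open>Y\<close>, so a null
    \<open>Y\<close> is treated apart.\<close>
  proof (cases "Y \<in> null_sets lebesgue")
    case True \<comment> \<open>all integrals vanish, and so does the quotient by \<open>measure lebesgue Y = 0\<close>\<close>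
    then show ?thesis
      using that[of "\<lambda>_ _. 0"] by (simp add: integral_lebesgue_on_null L2_on_def)
  next
    case False
    \<comment> \<open>Finiteness of the measure is square integrability of the constant 1, which
      transfers from \<open>X\<close> to \<open>Y\<close>.\<close>
    have "emeasure lebesgue Y < \<infinity>"
    proof -
      have "integrable (lebesgue_on X) (\<lambda>x. 1 :: real)"
        using X_meas X_fin
        by (intro finite_measure.integrable_const finite_measure_lebesgue_on) (simp add: fmeasurable_def)
      then have "L2_on X (\<lambda>x. 1)"
        by (simp add: L2_on_def)
      then have "L2_on Y (\<lambda>y. 1)"
        using L2_iff[of "\<lambda>_. 1"] by simp
      then show ?thesis
        using Y_sets by (simp add: L2_on_def integrable_restrict_space integrable_indicator_iff)
    qed
    then have Y: "Y \<in> lmeasurable"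
      using Y_sets by (simp add: fmeasurable_def)
    have slab: "slab Y i (Yset A X i) (Ycomp A X I Y0 i)" if i: "i \<in> I" for i
    proof
      show "0 < measure lebesgue Y"
        using False Y Y_sets \<open>emeasure lebesgue Y < \<infinity>\<close>
        by (auto simp: measure_def enn2real_positive_iff null_sets_def zero_less_iff_neq_zero simp del: emeasure_completion)
      show "Yset A X i \<in> lmeasurable"
        using Yi_meas i by (intro fmeasurableI) auto
      show "0 < measure lebesgue (Yset A X i)"
        using Yi_meas i by (auto simp: measure_def enn2real_positive_iff simp del: emeasure_completion)
      fix t and z :: "'n \<Rightarrow> real" assume z: "z \<in> PiE (- {i}) (\<lambda>_. UNIV)"
      \<comment> \<open>As \<open>i\<close> lies in \<open>I\<close>, restricting to
        \<open>- I\<close> forgets the inserted value \<open>t\<close>, so the condition involving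
        \<open>Y0\<close> concerns \<open>z\<close> alone.\<close>
      have "restrict (\<lambda>j. glue i t z $ j) (- I) = restrict z (- I)"
        using i by (auto simp: fun_eq_iff)
      moreover have "(\<forall>j\<in>I. glue i t z $ j \<in> Yset A X j) \<longleftrightarrow>
          t \<in> Yset A X i \<and> (\<forall>j\<in>I - {i}. z j \<in> Yset A X j)"
        using i by auto
      ultimately show "glue i t z \<in> Y \<longleftrightarrow> t \<in> Yset A X i \<and> z \<in> Ycomp A X I Y0 i"
        using z by (subst rset) (simp add: Ycomp_def del: glue_nth)
    qed (auto simp: Ycomp_def Y)
    have marg: "slab.marg i (Ycomp A X I Y0 i) ?u = marginal A X I Y0 f i" if "i \<in> I" for i
      by (simp add: fun_eq_iff marginal_def slab.marg_def[OF slab[OF that]] glue_def)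
    have u: "L2_on Y ?u"
      using f_L2 L2_iff[of ?u] by (simp flip: f_eq)
    show ?thesis
    proof (rule slabs_best_approximation[OF I_ne slab u], goal_cases)
      case (2 g)
      then show ?case
        by (intro that[of g]) (simp_all add: marg cong: sum.cong)
    qed
  qed
  show ?thesis
    unfolding approx_error_def
  \<comment> \<open>The infimum is attained at the ridge function built from \<open>g\<close>, so a
    lower bound for all competitors finishes the proof.\<close>
  proof (rule cInf_eq_minimum)
    have "(\<lambda>x. \<Sum>i\<in>I. g i ((A *v x) $ i)) \<in> ridge_space A I X"
      using g ridge by blast
    then show "inverse (sqrt \<bar>det A\<bar>) * sqrt ?E \<in> (\<lambda>h. L2norm_on X (\<lambda>x. f x - h x)) ` ridge_space A I X"
      by (rule rev_image_eqI) (simp only: norm g_eq)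
    fix v assume "v \<in> (\<lambda>h. L2norm_on X (\<lambda>x. f x - h x)) ` ridge_space A I X"
    then obtain k where k: "\<forall>i\<in>I. L2_on Y (\<lambda>y. k i (y $ i))"
      and v: "v = L2norm_on X (\<lambda>x. f x - (\<Sum>i\<in>I. k i ((A *v x) $ i)))"
      by (auto simp: ridge)
    show "inverse (sqrt \<bar>det A\<bar>) * sqrt ?E \<le> v"
      unfolding v norm using g_min[of k] k
      by (intro mult_left_mono real_sqrt_le_mono) auto
  qed
qed

end
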